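(* Let $m\ge1$. (a) The number of compact magic hypercubes of order $4$ and dimension $m$ is $4^m(2m+1)!$. (b) The number of most-perfect magic hypercubes of order $4$ and dimension $m$ is $4^m(2m)!$.
   Context: Consider arrangements of the numbers $1,2,\ldots,4^m$ (each used once) in a $4\times\cdots\times4$ ($m$-fold) grid with positions indexed by $(\mathbb Z/4\mathbb Z)^m$. Such an arrangement is a compact magic hypercube if all orthogonal lines (four positions obtained by fixing all but one coordinate) and all $2\times2$ subsquares (positions obtained by fixing all but two coordinates and letting those two range over $\{i,i+1\}\times\{k,k+1\}$ modulo $4$, so wrap-around subsquares are included) sum to the same magic constant. A great pandiagonal is a toroidal line $\{p+t\,d: t\in\mathbb Z/4\mathbb Z\}$ with $p\in(\mathbb Z/4\mathbb Z)^m$ and $d\in\{\pm1\}^m$ (this includes the great diagonals). The arrangement is a most-perfect magic hypercube if it is a compact magic hypercube, every great pandiagonal also sums to the magic constant, and every pair of entries lying two apart on a great pandiagonal sums to half the magic constant. Arrangements are counted as labelings (not up to symmetry). *)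

theory Defs
  imports "HOL-Analysis.Cartesian_Space"
begin

text \<open>
  Positions are elements of \<open>4 ^ 'm\<close>, where the numeral type \<open>4\<close> is the ring of integers
  modulo 4; all index arithmetic below is therefore toroidal. The dimension is \<open>CARD('m)\<close>,
  which ranges over all positive integers as \<open>'m\<close> ranges over the finite types.
\<close>

definition arrangement :: "(4 ^ 'm \<Rightarrow> nat) \<Rightarrow> bool" where
  "arrangement f \<longleftrightarrow> bij_betw f UNIV {1..4 ^ CARD('m)}"

definition orthogonal_line :: "'m \<Rightarrow> 4 ^ 'm \<Rightarrow> (4 ^ 'm) set" where
  "orthogonal_line j p = {x. \<forall>i. i \<noteq> j \<longrightarrow> x $ i = p $ i}"

definition subsquare :: "'m \<Rightarrow> 'm \<Rightarrow> 4 ^ 'm \<Rightarrow> (4 ^ 'm) set" where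
  "subsquare j l p = {x. x $ j \<in> {p $ j, p $ j + 1} \<and> x $ l \<in> {p $ l, p $ l + 1} \<and>
                         (\<forall>i. i \<noteq> j \<and> i \<noteq> l \<longrightarrow> x $ i = p $ i)}"

definition diagonal_directions :: "(4 ^ 'm) set" where
  "diagonal_directions = {d. \<forall>i. d $ i \<in> {1, -1}}"

definition great_pandiagonal :: "4 ^ 'm \<Rightarrow> 4 ^ 'm \<Rightarrow> (4 ^ 'm) set" where
  "great_pandiagonal p d = {p + t *s d | t. t \<in> UNIV}"

text \<open>The argument \<open>S\<close> of the following predicates is the magic constant.\<close>

definition compact_magic_with :: "nat \<Rightarrow> (4 ^ 'm \<Rightarrow> nat) \<Rightarrow> bool" where
  "compact_magic_with S f \<longleftrightarrow> arrangement f \<and>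
     (\<forall>j p. (\<Sum>x\<in>orthogonal_line j p. f x) = S) \<and>
     (\<forall>j l p. j \<noteq> l \<longrightarrow> (\<Sum>x\<in>subsquare j l p. f x) = S)"

text \<open>
  In the last clause, summing to half of \<open>S\<close> is written without division.
\<close>

definition most_perfect_with :: "nat \<Rightarrow> (4 ^ 'm \<Rightarrow> nat) \<Rightarrow> bool" where
  "most_perfect_with S f \<longleftrightarrow> compact_magic_with S f \<and>
     (\<forall>p. \<forall>d\<in>diagonal_directions. (\<Sum>x\<in>great_pandiagonal p d. f x) = S) \<and>
     (\<forall>p. \<forall>d\<in>diagonal_directions. \<forall>t.
        2 * (f (p + t *s d) + f (p + (t + 2) *s d)) = S)"

definition compact_magic_hypercube :: "(4 ^ 'm \<Rightarrow> nat) \<Rightarrow> bool" where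
  "compact_magic_hypercube f \<longleftrightarrow> (\<exists>S. compact_magic_with S f)"

definition most_perfect_magic_hypercube :: "(4 ^ 'm \<Rightarrow> nat) \<Rightarrow> bool" where
  "most_perfect_magic_hypercube f \<longleftrightarrow> (\<exists>S. most_perfect_with S f)"

end

theory Submission
  imports Defs "HOL-Library.Nat_Bijection" "HOL-Combinatorics.Permutations"
begin

text \<open>
  Subtract the mean \<open>S / 4\<close> from the entries and multiply by the alternating sign
  \<open>eps x = (-1) ^ (x\<^sub>1 + \<dots> + x\<^sub>m)\<close>. The subsquare conditions then say that all mixed second
  differences vanish, so the result is a sum of functions of single coordinates, and the line
  conditions say that each of these is a constant plus a function with \<open>a (t + 2) = - a t\<close>. Hence
  the centred labeling is a signed sum of \<open>2 m + 1\<close> real weights, and as \<open>x\<close> varies the signs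
  run through all sign vectors of product 1.

  The centred values are symmetric about 0. Comparing the sums of their exponentials with those of
  their negatives gives that the product of all \<open>exp (w i) - exp (- w i)\<close> is 0, so some weight
  vanishes. The sign of that weight is immaterial, so the subset sums of the doubled absolute values
  of the others run bijectively through \<open>0, \<dots>, 4 ^ m - 1\<close>, which forces these doubled values to
  be \<open>1, 2, 4, \<dots>, 2 ^ (2 m - 1)\<close>. Ordering the absolute values and choosing signs gives
  \<open>(2 m + 1)! 4 ^ m\<close> weight families. A labeling is most-perfect iff the constant weight, the one
  whose sign is \<open>eps\<close> alone, is the vanishing one, which leaves \<open>(2 m)! 4 ^ m\<close>.
\<close>

subsection \<open>Subset sums and powers of two\<close>

lemma bij_betw_comp_image_iff:
  assumes "inj g"
  shows "bij_betw (\<lambda>x. g (f x)) A (g ` B) \<longleftrightarrow> bij_betw f A B"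
proof -
  have "(\<lambda>x. g (f x)) ` A = g ` B \<longleftrightarrow> f ` A = B"
    using inj_image_eq_iff[OF assms, of "f ` A" B] by (simp add: image_image)
  then show ?thesis
    using assms by (auto simp: bij_betw_def inj_on_def inj_def)
qed

text \<open>Binary expansion. The encodings are bounded by
  \<open>1 + 2 + ... + 2 ^ (n - 1) < 2 ^ n\<close>, and an injective map into a set of the same
  finite size is onto.\<close>

lemma bij_betw_set_encode: "bij_betw set_encode (Pow {..<n}) {..<2 ^ n}"
proof -
  have inj: "inj_on set_encode (Pow {..<n})"
    by (rule inj_on_subset[OF inj_on_set_encode]) (auto intro: finite_subset)
  have "set_encode A < 2 ^ n" if "A \<subseteq> {..<n}" for A
  proof -
    have "set_encode A \<le> (\<Sum>i<n. 2 ^ i)"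
      unfolding set_encode_def by (rule sum_mono2) (use that in auto)
    also have "\<dots> < 2 ^ n"
      by (induction n) auto
    finally show ?thesis .
  qed
  then have "set_encode ` Pow {..<n} \<subseteq> {..<2 ^ n}"
    by auto
  moreover have "card (set_encode ` Pow {..<n}) = card {..<2 ^ n :: nat}"
    by (simp add: card_image[OF inj] card_Pow)
  ultimately show ?thesis
    using inj by (simp add: bij_betw_def card_subset_eq)
qed

text \<open>Sending each index to its exponent turns a subset sum into the \<open>set_encode\<close>
  of a set of exponents.\<close>

lemma subset_sums_powers_of_two:
  fixes b :: "'a \<Rightarrow> real"
  assumes "finite J" and b: "bij_betw b J ((\<lambda>k. 2 ^ k) ` {..<card J})"
  shows "bij_betw (sum b) (Pow J) (real ` {..<2 ^ card J})"
proof -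
  define \<phi> where "\<phi> = the_inv_into {..<card J} (\<lambda>k. 2 ^ k :: real) \<circ> b"
  have inj2: "inj_on (\<lambda>k. 2 ^ k :: real) {..<card J}"
    by (auto intro!: inj_onI)
  have \<phi>: "bij_betw \<phi> J {..<card J}"
    unfolding \<phi>_def
    by (rule bij_betw_trans[OF b bij_betw_the_inv_into])
      (simp add: inj2 inj_on_imp_bij_betw)
  have b_eq: "b j = 2 ^ \<phi> j" if "j \<in> J" for j
  proof -
    have "b j \<in> (\<lambda>k. 2 ^ k) ` {..<card J}"
      using b that by (rule bij_betwE[rule_format])
    then show ?thesis
      using f_the_inv_into_f[OF inj2] by (simp add: \<phi>_def)
  qed
  have "bij_betw (real \<circ> (set_encode \<circ> image \<phi>)) (Pow J) (real ` {..<2 ^ card J})"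
    by (intro bij_betw_trans[OF bij_betw_trans[OF bij_betw_Pow[OF \<phi>] bij_betw_set_encode]]
        inj_on_imp_bij_betw) (simp add: inj_on_def)
  moreover have "(real \<circ> (set_encode \<circ> image \<phi>)) B = sum b B" if "B \<in> Pow J" for B
  proof -
    have "inj_on \<phi> B"
      using \<phi> that by (auto simp: bij_betw_def intro: inj_on_subset)
    then have "set_encode (\<phi> ` B) = (\<Sum>j\<in>B. 2 ^ \<phi> j)"
      by (simp add: set_encode_def sum.reindex)
    moreover have "sum b B = (\<Sum>j\<in>B. 2 ^ \<phi> j)"
      by (rule sum.cong) (use b_eq that in auto)
    ultimately show ?thesis
      by simp
  qed
  ultimately show ?thesis
    using bij_betw_cong[of "Pow J" "real \<circ> (set_encode \<circ> image \<phi>)" "sum b"] by blast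
qed

text \<open>Distinct subset sums make \<open>b\<close> injective, so by counting it suffices that
  every \<open>2 ^ k\<close> with \<open>k < card J\<close> is a value. These values are found in
  increasing order, by strong induction on \<open>k\<close>.\<close>

lemma subset_sums_imp_powers_of_two:
  fixes b :: "'a \<Rightarrow> real"
  assumes fin: "finite J" and sums: "bij_betw (sum b) (Pow J) (real ` {..<2 ^ card J})"
  shows "bij_betw b J ((\<lambda>k. 2 ^ k) ` {..<card J})"
proof -
  have inj: "A = B" if "A \<subseteq> J" "B \<subseteq> J" "sum b A = sum b B" for A B
    using sums that by (auto simp: bij_betw_def inj_on_def)
  have inj_b: "inj_on b J"
  proof (rule inj_onI)
    fix i j assume "i \<in> J" "j \<in> J" "b i = b j"
    then show "i = j"
      using inj[of "{i}" "{j}"] by auto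
  qed
  have nat_b: "\<exists>n. b j = real n" if "j \<in> J" for j
  proof -
    have "sum b {j} \<in> real ` {..<2 ^ card J}"
      using bij_betwE[OF sums] that by blast
    then show ?thesis
      by auto
  qed
  have nonneg: "b j \<ge> 0" if "j \<in> J" for j
    using nat_b[OF that] by auto
  have ex: "\<exists>j\<in>J. b j = 2 ^ k" if "k < card J" for k
    using that
  proof (induction k rule: less_induct)
    case (less k)
    define K where "K = {j \<in> J. b j \<in> (\<lambda>i. 2 ^ i) ` {..<k}}"
    have "K \<subseteq> J" "finite K"
      using fin by (auto simp: K_def)
    have img: "b ` K = (\<lambda>i. 2 ^ i) ` {..<k}"
    proof
      show "(\<lambda>i. 2 ^ i) ` {..<k} \<subseteq> b ` K"
      proof clarify
        fix i assume "i < k"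
        then obtain j where "j \<in> J" "b j = 2 ^ i"
          using less.IH[of i] less.prems by auto
        with \<open>i < k\<close> show "2 ^ i \<in> b ` K"
          by (intro image_eqI[of _ _ j]) (auto simp: K_def)
      qed
    qed (auto simp: K_def)
    have bij_K: "bij_betw b K ((\<lambda>i. 2 ^ i) ` {..<k})"
      using inj_on_subset[OF inj_b \<open>K \<subseteq> J\<close>] img by (simp add: bij_betw_def)
    have "card K = k"
      using bij_betw_same_card[OF bij_K] by (simp add: card_image inj_on_def)
    have covered: "real ` {..<2 ^ k} = sum b ` Pow K"
      using subset_sums_powers_of_two[OF \<open>finite K\<close>] bij_K \<open>card K = k\<close>
      by (simp add: bij_betw_def)
    have "(2::nat) ^ k < 2 ^ card J"
      using less.prems by simp
    then have "real (2 ^ k) \<in> sum b ` Pow J"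
      using sums unfolding bij_betw_def by blast
    then obtain A where A: "A \<subseteq> J" "sum b A = 2 ^ k"
      by auto
    \<comment> \<open>A subset sum equal to \<open>2 ^ k\<close> needs an element outside \<open>K\<close>; by injectivity the elements
      below \<open>2 ^ k\<close> all lie in \<open>K\<close>, whose total is only \<open>2 ^ k - 1\<close>.\<close>
    have "\<exists>j\<in>A. b j \<ge> 2 ^ k"
    proof (rule ccontr)
      assume "\<not> ?thesis"
      then have small: "b j < 2 ^ k" if "j \<in> A" for j
        using that by force
      have "A \<subseteq> K"
      proof
        fix j assume j: "j \<in> A"
        then have "j \<in> J"
          using A by auto
        then obtain n where n: "b j = real n"
          using nat_b by blast
        have "real n < real (2 ^ k)"
          using small[OF j] n by simp
        then have "b j \<in> sum b ` Pow K"
          unfolding covered[symmetric] n using of_nat_less_iff by blast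
        then obtain C where C: "C \<subseteq> K" "sum b {j} = sum b C"
          by auto
        then have "{j} = C"
          using inj[of "{j}" C] \<open>j \<in> J\<close> \<open>K \<subseteq> J\<close> by blast
        then show "j \<in> K"
          using C by auto
      qed
      then have "sum b A \<in> real ` {..<2 ^ k}"
        unfolding covered by auto
      then obtain m where m: "m < 2 ^ k" "sum b A = real m"
        by auto
      then have "real m = real (2 ^ k)"
        using A by simp
      then show False
        using m by (simp only: of_nat_eq_iff)
    qed
    then obtain j where j: "j \<in> A" "b j \<ge> 2 ^ k"
      by auto
    \<comment> \<open>As all values are nonnegative and \<open>sum b A = 2 ^ k\<close>, this
      squeezes \<open>b j\<close> to exactly \<open>2 ^ k\<close>.\<close>
    have "b j \<le> sum b A"
      using j A nonneg by (intro member_le_sum finite_subset[OF _ fin]) auto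
    then show ?case
      using j A by force
  qed
  have "(\<lambda>k. 2 ^ k) ` {..<card J} \<subseteq> b ` J"
    using ex by force
  moreover have "card ((\<lambda>k. 2 ^ k :: real) ` {..<card J}) = card (b ` J)"
    by (simp add: card_image[OF inj_b] card_image inj_on_def)
  ultimately have "(\<lambda>k. 2 ^ k) ` {..<card J} = b ` J"
    using fin by (intro card_subset_eq) auto
  then show ?thesis
    using inj_b by (simp add: bij_betw_def)
qed

section \<open>Counting bijections and signed bijections\<close>

text \<open>Composition with one fixed bijection identifies these maps with the permutations of the
  index type.\<close>

lemma card_bij_UNIV:
  assumes "finite P" "card P = CARD('i::finite)"
  shows "card {\<phi> :: 'i \<Rightarrow> 'a. bij_betw \<phi> UNIV P} = fact CARD('i)"
proof -
  obtain h :: "'a \<Rightarrow> 'i" where h: "bij_betw h P UNIV"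
    using finite_same_card_bij[OF assms(1) finite assms(2)] by auto
  define k where "k = inv_into P h"
  have k: "bij_betw k UNIV P"
    unfolding k_def using h by (rule bij_betw_inv_into)
  have hk: "h (k i) = i" for i
    unfolding k_def using h by (auto simp: bij_betw_def intro!: f_inv_into_f)
  have kh: "k (h y) = y" if "y \<in> P" for y
    unfolding k_def using h that by (auto simp: bij_betw_def)
  have "bij_betw (\<lambda>\<pi>. k \<circ> \<pi>) {\<pi>. \<pi> permutes UNIV} {\<phi> :: 'i \<Rightarrow> 'a. bij_betw \<phi> UNIV P}"
  proof (rule bij_betw_byWitness[where f' = "\<lambda>\<phi>. h \<circ> \<phi>"])
    show "\<forall>\<pi>\<in>{\<pi>. \<pi> permutes UNIV}. h \<circ> (k \<circ> \<pi>) = \<pi>"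
      by (auto simp: hk fun_eq_iff)
    show "\<forall>\<phi>\<in>{\<phi>. bij_betw \<phi> UNIV P}. k \<circ> (h \<circ> \<phi>) = \<phi>"
      by (auto simp: fun_eq_iff intro!: kh dest: bij_betwE)
    show "(\<lambda>\<pi>. k \<circ> \<pi>) ` {\<pi>. \<pi> permutes UNIV} \<subseteq> {\<phi>. bij_betw \<phi> UNIV P}"
      using k by (auto intro: bij_betw_trans permutes_imp_bij)
    show "(\<lambda>\<phi>. h \<circ> \<phi>) ` {\<phi>. bij_betw \<phi> UNIV P} \<subseteq> {\<pi>. \<pi> permutes UNIV}"
      using h by (auto intro!: bij_imp_permutes bij_betw_trans)
  qed
  then show ?thesis
    using card_permutations[of "UNIV :: 'i set"] by (auto dest: bij_betw_same_card)
qed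

text \<open>Since the absolute values are distinct, the signs can be recorded as the set
  \<open>neg w\<close> of those absolute values that are taken with a minus sign. Zero carries no
  sign, hence the exponent \<open>card (P - {0})\<close>.\<close>

lemma card_abs_bij_UNIV:
  fixes P :: "real set"
  assumes "finite P" "card P = CARD('i::finite)" and nonneg: "\<And>p. p \<in> P \<Longrightarrow> 0 \<le> p"
  shows "card {w :: 'i \<Rightarrow> real. bij_betw (\<lambda>i. \<bar>w i\<bar>) UNIV P} = fact CARD('i) * 2 ^ card (P - {0})"
proof -
  let ?W = "{w :: 'i \<Rightarrow> real. bij_betw (\<lambda>i. \<bar>w i\<bar>) UNIV P}"
  let ?B = "{\<phi> :: 'i \<Rightarrow> real. bij_betw \<phi> UNIV P}"
  define neg where "neg w = {\<bar>w i\<bar> | i. w i < 0}" for w :: "'i \<Rightarrow> real"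
  have "bij_betw (\<lambda>w. (\<lambda>i. \<bar>w i\<bar>, neg w)) ?W (?B \<times> Pow (P - {0}))"
  proof (rule bij_betw_byWitness[where f' = "\<lambda>(\<phi>, X) i. if \<phi> i \<in> X then - \<phi> i else \<phi> i"])
    show "\<forall>w\<in>?W. (case (\<lambda>i. \<bar>w i\<bar>, neg w) of (\<phi>, X) \<Rightarrow> \<lambda>i. if \<phi> i \<in> X then - \<phi> i else \<phi> i) = w"
    proof
      fix w assume "w \<in> ?W"
      then have "inj (\<lambda>i. \<bar>w i\<bar>)"
        by (auto simp: bij_betw_def)
      then have "\<bar>w i\<bar> \<in> neg w \<longleftrightarrow> w i < 0" for i
        by (auto simp: neg_def inj_def)
      then show "(case (\<lambda>i. \<bar>w i\<bar>, neg w) of (\<phi>, X) \<Rightarrow> \<lambda>i. if \<phi> i \<in> X then - \<phi> i else \<phi> i) = w"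
        by (auto simp: fun_eq_iff)
    qed
    have abs_eq: "\<bar>if \<phi> i \<in> X then - \<phi> i else \<phi> i\<bar> = \<phi> i" if "\<phi> \<in> ?B" for \<phi> i X
      using nonneg[of "\<phi> i"] that by (auto dest: bij_betwE)
    have neg_eq: "neg (\<lambda>i. if \<phi> i \<in> X then - \<phi> i else \<phi> i) = X"
      if \<phi>: "\<phi> \<in> ?B" and X: "X \<subseteq> P - {0}" for \<phi> X
    proof -
      have "\<phi> i \<ge> 0" for i
        using nonneg[of "\<phi> i"] \<phi> by (auto dest: bij_betwE)
      then have "(if \<phi> i \<in> X then - \<phi> i else \<phi> i) < 0 \<longleftrightarrow> \<phi> i \<in> X" for i
        using X by (auto intro: order.antisym simp: order_less_le)
      then have "neg (\<lambda>i. if \<phi> i \<in> X then - \<phi> i else \<phi> i) = X \<inter> range \<phi>"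
        unfolding neg_def abs_eq[OF \<phi>] by auto
      also have "\<dots> = X"
        using \<phi> X by (auto simp: bij_betw_def)
      finally show ?thesis .
    qed
    show "\<forall>z\<in>?B \<times> Pow (P - {0}).
        (\<lambda>w. (\<lambda>i. \<bar>w i\<bar>, neg w)) (case z of (\<phi>, X) \<Rightarrow> \<lambda>i. if \<phi> i \<in> X then - \<phi> i else \<phi> i) = z"
      using abs_eq neg_eq by (auto simp: fun_eq_iff)
    show "(\<lambda>w. (\<lambda>i. \<bar>w i\<bar>, neg w)) ` ?W \<subseteq> ?B \<times> Pow (P - {0})"
      by (auto simp: neg_def dest: bij_betwE)
    show "(\<lambda>(\<phi>, X) i. if \<phi> i \<in> X then - \<phi> i else \<phi> i) ` (?B \<times> Pow (P - {0})) \<subseteq> ?W"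
      using abs_eq by auto
  qed
  then have "card ?W = card (?B \<times> Pow (P - {0}))"
    by (rule bij_betw_same_card)
  then show ?thesis
    using assms by (simp add: card_cartesian_product card_bij_UNIV card_Pow)
qed

subsection \<open>Signed sums with sign product 1\<close>

definition balanced_signs :: "('i::finite \<Rightarrow> real) set" where
  "balanced_signs = {s. (\<forall>i. s i \<in> {1, -1}) \<and> prod s UNIV = 1}"

text \<open>The offset \<open>(N - 1) / 2\<close> is the mean of \<open>0, ..., N - 1\<close>; the
  set is therefore symmetric about 0.\<close>

definition centered :: "nat \<Rightarrow> real set" where
  "centered N = (\<lambda>k. real k - (real N - 1) / 2) ` {..<N}"

text \<open>Flipping a sign changes a signed sum by twice the weight, so it is the doubled weights
  that have to be powers of two.\<close>

definition half_powers :: "nat \<Rightarrow> real set" where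
  "half_powers n = (\<lambda>k. 2 ^ k / 2) ` {..<n}"

lemma finite_balanced_signs: "finite (balanced_signs :: ('i::finite \<Rightarrow> real) set)"
  by (rule finite_subset[of _ "Pi\<^sub>E UNIV (\<lambda>_. {1, -1})"])
    (auto simp: balanced_signs_def intro: finite_PiE)

lemma prod_signs_cases:
  fixes s :: "'i \<Rightarrow> real"
  assumes "\<And>i. i \<in> A \<Longrightarrow> s i \<in> {1, -1}"
  shows "prod s A \<in> {1, -1}"
  using assms
proof (induction A rule: infinite_finite_induct)
  case (insert i A)
  then have "s i \<in> {1, -1}" "prod s A \<in> {1, -1}"
    by blast+
  then show ?case
    using insert.hyps by auto
qed auto

text \<open>The substitution of \<open>N - 1 - k\<close> for \<open>k\<close>. In this form centred
  values appear as a maximum minus a subset sum.\<close>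

lemma image_reflect_centered:
  "(\<lambda>y. (real N - 1) / 2 - y) ` real ` {..<N} = centered N"
proof -
  have "(\<lambda>k. N - 1 - k) ` {..<N} = {..<N}"
  proof
    show "{..<N} \<subseteq> (\<lambda>k. N - 1 - k) ` {..<N}"
    proof
      fix k assume "k \<in> {..<N}"
      then show "k \<in> (\<lambda>k. N - 1 - k) ` {..<N}"
        by (intro image_eqI[of _ _ "N - 1 - k"]) auto
    qed
  qed auto
  then have "centered N = (\<lambda>k. real k - (real N - 1) / 2) ` (\<lambda>k. N - 1 - k) ` {..<N}"
    by (simp only: centered_def)
  also have "\<dots> = (\<lambda>k. (real N - 1) / 2 - real k) ` {..<N}"
    by (auto simp: image_image of_nat_diff field_simps intro!: image_cong)
  finally show ?thesis
    by (simp add: image_image)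
qed

lemma uminus_image_centered: "uminus ` centered N = centered N"
  unfolding image_reflect_centered[of N, symmetric] 
  by (subst (2) image_reflect_centered) (simp add: centered_def image_image)

text \<open>
  For an odd number of signs, negation exchanges the sign vectors of product 1 and of product
  \<open>-1\<close>, so the difference of the two sides of the hypothesis is the product of the
  \<open>exp (w i) - exp (- w i)\<close>.
\<close>

lemma exists_zero_weight:
  fixes w :: "'i::finite \<Rightarrow> real"
  assumes odd: "odd CARD('i)"
    and sym: "(\<Sum>s\<in>balanced_signs. exp (\<Sum>i\<in>UNIV. s i * w i))
            = (\<Sum>s\<in>balanced_signs. exp (- (\<Sum>i\<in>UNIV. s i * w i)))"
  shows "\<exists>i. w i = 0"
proof -
  let ?Z = "Pi\<^sub>E (UNIV :: 'i set) (\<lambda>_. {1, -1 :: real})"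
  let ?F = "\<lambda>s. prod s UNIV * exp (\<Sum>i\<in>UNIV. s i * w i)"
  let ?neg = "\<lambda>(s :: 'i \<Rightarrow> real) i. - s i"
  have prod_neg: "prod (?neg s) UNIV = - prod s UNIV" for s
    using odd by (simp add: prod_uminus)
  have split: "?Z = balanced_signs \<union> ?neg ` balanced_signs"
  proof
    show "?Z \<subseteq> balanced_signs \<union> ?neg ` balanced_signs"
    proof
      fix s assume "s \<in> ?Z"
      then have s: "s i \<in> {1, -1}" for i
        by auto
      consider "prod s UNIV = 1" | "prod s UNIV = - 1"
        using prod_signs_cases[of UNIV s] s by auto
      then show "s \<in> balanced_signs \<union> ?neg ` balanced_signs"
      proof cases
        case 1
        then show ?thesis using s by (simp add: balanced_signs_def)
      next
        case 2
        have "?neg s i \<in> {1, -1}" for i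
          using s[of i] by auto
        then have "?neg s \<in> balanced_signs"
          using 2 prod_neg[of s] by (simp add: balanced_signs_def)
        then have "s \<in> ?neg ` balanced_signs"
          by (intro image_eqI[of _ _ "?neg s"]) auto
        then show ?thesis ..
      qed
    qed
    show "balanced_signs \<union> ?neg ` balanced_signs \<subseteq> ?Z"
      by (auto simp: balanced_signs_def)
  qed
  have disj: "balanced_signs \<inter> ?neg ` balanced_signs = {}"
    using prod_neg by (auto simp: balanced_signs_def)
  have "(\<Prod>i\<in>UNIV. exp (w i) - exp (- w i)) = (\<Prod>i\<in>UNIV. \<Sum>t\<in>{1, -1}. t * exp (t * w i))"
    by simp
  also have "\<dots> = (\<Sum>s\<in>?Z. \<Prod>i\<in>UNIV. s i * exp (s i * w i))"
    by (rule prod_sum_PiE) auto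
  also have "\<dots> = sum ?F ?Z"
    by (simp add: prod.distrib exp_sum)
  also have "\<dots> = sum ?F balanced_signs + sum ?F (?neg ` balanced_signs)"
    unfolding split using disj by (intro sum.union_disjoint) (auto simp: finite_balanced_signs)
  also have "sum ?F (?neg ` balanced_signs) = (\<Sum>s\<in>balanced_signs. ?F (?neg s))"
    by (subst sum.reindex) (auto simp: inj_on_def fun_eq_iff)
  \<comment> \<open>Negating \<open>s\<close> flips both the sign product and the exponent, so
    \<open>sym\<close> makes the two halves cancel.\<close>
  also have "sum ?F balanced_signs + \<dots> = 0"
    using sym by (simp add: prod_neg balanced_signs_def sum_negf)
  finally obtain i where "exp (w i) - exp (- w i) = 0"
    by auto
  then show ?thesis
    by auto
qed

text \<open>
  The sign at \<open>i0\<close> is free to fix the product of the signs, and a signed sum is the maximal one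
  minus twice the sum of those \<open>\<bar>w i\<bar>\<close> whose term is negative.
\<close>

lemma balanced_sums_iff_subset_sums:
  fixes w :: "'i::finite \<Rightarrow> real"
  assumes w0: "w i0 = 0"
  shows "bij_betw (\<lambda>s. \<Sum>i\<in>UNIV. s i * w i) balanced_signs (centered (2 ^ n)) \<longleftrightarrow>
    bij_betw (sum (\<lambda>i. 2 * \<bar>w i\<bar>)) (Pow (- {i0})) (real ` {..<2 ^ n})"
proof -
  define e :: "'i \<Rightarrow> real" where "e i = (if w i < 0 then -1 else 1)" for i
  \<comment> \<open>With \<open>e\<close> as the sign of \<open>w\<close> (1 at zero),
    \<open>s i = - e i\<close> says that the term \<open>s i * w i\<close> is
    \<open>- \<bar>w i\<bar>\<close>.\<close>
  define \<theta> where "\<theta> s = {i. i \<noteq> i0 \<and> s i = - e i}" for s :: "'i \<Rightarrow> real"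
  define W where "W = (\<Sum>i\<in>UNIV. \<bar>w i\<bar>)"
  define b where "b = (\<lambda>i. 2 * \<bar>w i\<bar>)"
  define M :: real where "M = (real (2 ^ n) - 1) / 2"
  define \<sigma> where "\<sigma> B i = (if i \<in> B then - e i else e i)" for B i
  \<comment> \<open>The entry at \<open>i0\<close> repeats the product of all other signs, so the
    total product is the square of a sign.\<close>
  define lift where "lift B i = (if i = i0 then \<Prod>j\<in>-{i0}. \<sigma> B j else \<sigma> B i)" for B i
  have \<sigma>: "\<sigma> B i \<in> {1, -1}" for B i
    by (simp add: \<sigma>_def e_def)
  have prod_eq: "prod s UNIV = s i0 * prod s (- {i0})" for s :: "'i \<Rightarrow> real"
    by (subst prod.remove[of _ i0]) (auto simp: Compl_eq_Diff_UNIV)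
  have \<theta>: "bij_betw \<theta> balanced_signs (Pow (- {i0}))"
  proof (rule bij_betw_byWitness[where f' = lift])
    show "\<forall>s\<in>balanced_signs. lift (\<theta> s) = s"
    proof
      fix s :: "'i \<Rightarrow> real" assume s: "s \<in> balanced_signs"
      have other: "\<sigma> (\<theta> s) i = s i" if "i \<noteq> i0" for i
        using s that by (auto simp: \<sigma>_def \<theta>_def e_def balanced_signs_def)
      have "s i0 * prod s (- {i0}) = 1" "s i0 \<in> {1, -1}"
        using s prod_eq[of s] by (auto simp: balanced_signs_def)
      then have "s i0 = prod s (- {i0})"
        by auto
      then show "lift (\<theta> s) = s"
        using other by (auto simp: lift_def fun_eq_iff intro!: prod.cong)
    qed
    show "\<forall>B\<in>Pow (- {i0}). \<theta> (lift B) = B"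
      by (auto simp: \<theta>_def lift_def \<sigma>_def e_def split: if_splits)
    show "\<theta> ` balanced_signs \<subseteq> Pow (- {i0})"
      by (auto simp: \<theta>_def)
    have "lift B \<in> balanced_signs" for B
    proof -
      have "prod (lift B) (- {i0}) = (\<Prod>j\<in>-{i0}. \<sigma> B j)"
        by (rule prod.cong) (auto simp: lift_def)
      moreover have P: "(\<Prod>j\<in>-{i0}. \<sigma> B j) \<in> {1, -1}"
        by (rule prod_signs_cases) (rule \<sigma>)
      ultimately have "prod (lift B) UNIV = 1"
        unfolding prod_eq by (auto simp: lift_def)
      moreover have "lift B i \<in> {1, -1}" for i
        using P \<sigma> unfolding lift_def by presburger
      ultimately show ?thesis
        by (simp add: balanced_signs_def)
    qed
    then show "lift ` Pow (- {i0}) \<subseteq> balanced_signs"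
      by blast
  qed
  have sum_eq: "(\<Sum>i\<in>UNIV. s i * w i) = W - sum b (\<theta> s)" if s: "s \<in> balanced_signs" for s
  proof -
    have "s i * w i = \<bar>w i\<bar> - (if i \<in> \<theta> s then b i else 0)" for i
    proof -
      have "s i = 1 \<or> s i = -1"
        using s by (auto simp: balanced_signs_def)
      then show ?thesis
        using w0 by (auto simp: \<theta>_def e_def b_def)
    qed
    then show ?thesis
      by (simp add: W_def sum_subtractf sum.inter_restrict[symmetric])
  qed
  have "bij_betw (\<lambda>s. \<Sum>i\<in>UNIV. s i * w i) balanced_signs (centered (2 ^ n)) \<longleftrightarrow>
      bij_betw ((\<lambda>B. W - sum b B) \<circ> \<theta>) balanced_signs (centered (2 ^ n))"
    by (rule bij_betw_cong) (simp add: sum_eq)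
  also have "\<dots> \<longleftrightarrow> bij_betw (\<lambda>B. W - sum b B) (Pow (- {i0})) (centered (2 ^ n))"
    by (rule bij_betw_comp_iff[OF \<theta>, symmetric])
  finally have iff: "bij_betw (\<lambda>s. \<Sum>i\<in>UNIV. s i * w i) balanced_signs (centered (2 ^ n)) \<longleftrightarrow>
      bij_betw (\<lambda>B. W - sum b B) (Pow (- {i0})) (centered (2 ^ n))" .
  have sum_nonneg: "sum b B \<ge> 0" for B
    by (simp add: b_def sum_nonneg)
  have centered_le: "x \<le> M" if x: "x \<in> centered (2 ^ n)" for x
  proof -
    obtain k where "k < 2 ^ n" "x = real k - M"
      using x unfolding centered_def M_def by blast
    moreover from this have "real (k + 1) \<le> real (2 ^ n)"
      by (subst of_nat_le_iff) simp
    ultimately show ?thesis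
      by (simp add: M_def field_simps)
  qed
  have sums_le: "x \<le> 2 * M" if x: "x \<in> real ` {..<2 ^ n}" for x
  proof -
    obtain k where "k < 2 ^ n" "x = real k"
      using x by auto
    moreover from this have "real (k + 1) \<le> real (2 ^ n)"
      by (subst of_nat_le_iff) simp
    ultimately show ?thesis
      by (simp add: M_def)
  qed
  have max_sums: "2 * M \<in> real ` {..<2 ^ n}"
    by (intro image_eqI[of _ _ "2 ^ n - 1"]) (auto simp: M_def of_nat_diff)
  have image_M: "(\<lambda>y. M - y) ` real ` {..<2 ^ n} = centered (2 ^ n)"
    using image_reflect_centered[of "2 ^ n"] by (simp add: M_def)
  \<comment> \<open>Either bijection forces \<open>W = M\<close> by comparing maxima: the largest
    signed sum is \<open>W\<close>, at the empty set, against \<open>M\<close>; the largest subset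
    sum is \<open>2 * W\<close>, at the full set, against \<open>2 * M\<close>. Then
    \<open>y \<mapsto> M - y\<close> carries one bijection to the other.\<close>
  have "W = M" if bij: "bij_betw (\<lambda>B. W - sum b B) (Pow (- {i0})) (centered (2 ^ n))"
  proof (rule antisym)
    show "W \<le> M"
      using bij_betwE[OF bij] by (intro centered_le) (force dest: bspec[where x = "{}"])
    have "M - 0 \<in> (\<lambda>y. M - y) ` real ` {..<2 ^ n}"
      by (intro imageI) (rule image_eqI[of _ _ 0], auto)
    then have "M \<in> (\<lambda>B. W - sum b B) ` Pow (- {i0})"
      using bij unfolding image_M bij_betw_def by simp
    then obtain B where "M = W - sum b B"
      by auto
    then show "M \<le> W"
      using sum_nonneg[of B] by simp
  qed
  moreover have "W = M" if bij: "bij_betw (sum b) (Pow (- {i0})) (real ` {..<2 ^ n})"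
  proof -
    have "sum b (- {i0}) = (\<Sum>i\<in>UNIV. b i)"
      using w0 by (intro sum.mono_neutral_left) (auto simp: b_def)
    then have total: "sum b (- {i0}) = 2 * W"
      by (simp add: W_def b_def sum_distrib_left)
    have "sum b (- {i0}) \<in> real ` {..<2 ^ n}"
      using bij_betwE[OF bij] by blast
    then have "2 * W \<le> 2 * M"
      unfolding total[symmetric] by (rule sums_le)
    moreover obtain B where "B \<subseteq> - {i0}" "2 * M = sum b B"
      using max_sums bij by (auto simp: bij_betw_def)
    moreover have "sum b B \<le> sum b (- {i0})" if "B \<subseteq> - {i0}" for B
      using that by (intro sum_mono2) (auto simp: b_def)
    ultimately show ?thesis
      using total by fastforce
  qed
  moreover have "bij_betw (\<lambda>B. M - sum b B) (Pow (- {i0})) (centered (2 ^ n)) \<longleftrightarrow>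
      bij_betw (sum b) (Pow (- {i0})) (real ` {..<2 ^ n})"
  proof -
    have "inj (\<lambda>y. M - y)"
      by (simp add: inj_def)
    then show ?thesis
      unfolding image_M[symmetric] by (rule bij_betw_comp_image_iff)
  qed
  ultimately show ?thesis
    unfolding iff b_def by blast
qed

text \<open>Each side produces a vanishing weight: the left because \<open>centered\<close> is
  closed under negation and the number of weights is odd, the right because 0 lies in the target.
  With that weight set aside, the signed sums become subset sums of the doubled absolute values,
  which must be \<open>1, 2, 4, ...\<close>.\<close>

lemma balanced_sums_iff:
  fixes w :: "'i::finite \<Rightarrow> real"
  assumes card: "CARD('i) = Suc n" and "even n"
  shows "bij_betw (\<lambda>s. \<Sum>i\<in>UNIV. s i * w i) balanced_signs (centered (2 ^ n)) \<longleftrightarrow>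
    bij_betw (\<lambda>i. \<bar>w i\<bar>) UNIV (insert 0 (half_powers n))"
    (is "?sums \<longleftrightarrow> ?abs")
proof -
  have "\<exists>i. w i = 0" if ?sums
  proof (rule exists_zero_weight)
    show "odd CARD('i)"
      using assms by simp
    have "(\<Sum>s\<in>balanced_signs. exp (- (\<Sum>i\<in>UNIV. s i * w i))) = (\<Sum>x\<in>centered (2 ^ n). exp (- x))"
      by (rule sum.reindex_bij_betw[OF that])
    also have "\<dots> = (\<Sum>x\<in>uminus ` centered (2 ^ n). exp x)"
      by (simp add: sum.reindex)
    also have "\<dots> = (\<Sum>s\<in>balanced_signs. exp (\<Sum>i\<in>UNIV. s i * w i))"
      unfolding uminus_image_centered by (rule sum.reindex_bij_betw[OF that, symmetric])
    finally show "(\<Sum>s\<in>balanced_signs. exp (\<Sum>i\<in>UNIV. s i * w i)) =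
        (\<Sum>s\<in>balanced_signs. exp (- (\<Sum>i\<in>UNIV. s i * w i)))" ..
  qed
  moreover have "\<exists>i. w i = 0" if ?abs
  proof -
    have "0 \<in> range (\<lambda>i. \<bar>w i\<bar>)"
      using that by (simp add: bij_betw_def)
    then show ?thesis
      by auto
  qed
  moreover have "?sums \<longleftrightarrow> ?abs" if w0: "w i0 = 0" for i0
  proof -
    let ?J = "- {i0}"
    have cardJ: "card ?J = n"
      using card by (simp add: Compl_eq_Diff_UNIV)
    have "?sums \<longleftrightarrow> bij_betw (sum (\<lambda>i. 2 * \<bar>w i\<bar>)) (Pow ?J) (real ` {..<2 ^ n})"
      using w0 by (rule balanced_sums_iff_subset_sums)
    also have "\<dots> \<longleftrightarrow> bij_betw (\<lambda>i. 2 * \<bar>w i\<bar>) ?J ((\<lambda>k. 2 ^ k) ` {..<n})"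
      using subset_sums_powers_of_two[of ?J "\<lambda>i. 2 * \<bar>w i\<bar>"]
        subset_sums_imp_powers_of_two[of ?J "\<lambda>i. 2 * \<bar>w i\<bar>"] cardJ by auto
    also have "\<dots> \<longleftrightarrow> bij_betw (\<lambda>i. \<bar>w i\<bar>) ?J (half_powers n)"
    proof -
      have "inj ((*) (2 :: real))"
        by (simp add: inj_def)
      moreover have "(\<lambda>k. 2 ^ k) ` {..<n} = (*) 2 ` half_powers n"
        by (simp add: half_powers_def image_image)
      ultimately show ?thesis
        using bij_betw_comp_image_iff[of "(*) 2" "\<lambda>i. \<bar>w i\<bar>" ?J "half_powers n"] by simp
    qed
    also have "\<dots> \<longleftrightarrow> bij_betw (\<lambda>i. \<bar>w i\<bar>) (?J \<union> {i0}) (half_powers n \<union> {\<bar>w i0\<bar>})"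
      by (rule notIn_Un_bij_betw3) (auto simp: w0 half_powers_def)
    also have "?J \<union> {i0} = UNIV"
      by auto
    finally show ?thesis
      by (simp add: w0)
  qed
  ultimately show ?thesis
    by blast
qed

subsection \<open>The linear magic conditions\<close>

lemma Z4_cases: "(t :: 4) = 0 \<or> t = 1 \<or> t = 2 \<or> t = 3"
  using exhaust_4[of t] by auto

lemma sum_Z4: "sum f (UNIV :: 4 set) = f 0 + f 1 + f 2 + f 3"
proof -
  have UNIV_eq: "UNIV = {0, 1, 2, 3 :: 4}"
    using Z4_cases by auto
  show ?thesis
    unfolding UNIV_eq by (simp add: add.assoc)
qed

lemma sum_UNIV_option_sum:
  "sum f (UNIV :: ('m::finite + 'm) option set)
    = f None + (\<Sum>j\<in>UNIV. f (Some (Inl j))) + (\<Sum>j\<in>UNIV. f (Some (Inr j)))"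
  unfolding UNIV_option_conv UNIV_sum image_Un
  by (subst sum.insert, simp, blast, subst sum.union_disjoint)
    (auto simp: sum.reindex add.assoc)

lemma prod_UNIV_option_sum:
  "prod f (UNIV :: ('m::finite + 'm) option set)
    = f None * (\<Prod>j\<in>UNIV. f (Some (Inl j))) * (\<Prod>j\<in>UNIV. f (Some (Inr j)))"
  unfolding UNIV_option_conv UNIV_sum image_Un
  by (subst prod.insert, simp, blast, subst prod.union_disjoint)
    (auto simp: prod.reindex mult.assoc)

lemma axis_add: "axis j s + axis j t = axis j (s + t :: 'a::monoid_add)"
  by (simp add: vec_eq_iff axis_def)

lemma sum_orthogonal_line: "sum f (orthogonal_line j p) = (\<Sum>t\<in>UNIV. f (p + axis j t))"
proof -
  have "x \<in> range (\<lambda>t. p + axis j t)" if "\<forall>i. i \<noteq> j \<longrightarrow> x $ i = p $ i" for x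
    using that by (intro image_eqI[of _ _ "x $ j - p $ j"]) (auto simp: vec_eq_iff axis_def)
  then have "orthogonal_line j p = range (\<lambda>t. p + axis j t)"
    by (auto simp: orthogonal_line_def axis_def)
  moreover have "inj (\<lambda>t. p + axis j t)"
    by (auto intro!: injI simp: axis_eq_axis)
  ultimately show ?thesis
    by (simp add: sum.reindex)
qed

lemma sum_subsquare:
  assumes "j \<noteq> l"
  shows "sum f (subsquare j l p)
    = f p + f (p + axis j 1) + f (p + axis l 1) + f (p + axis j 1 + axis l 1)"
proof -
  have "x \<in> {p, p + axis j 1, p + axis l 1, p + axis j 1 + axis l 1}" if "x \<in> subsquare j l p" for x
  proof -
    have "x $ j = p $ j \<or> x $ j = p $ j + 1" "x $ l = p $ l \<or> x $ l = p $ l + 1"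
      "\<And>i. i \<noteq> j \<Longrightarrow> i \<noteq> l \<Longrightarrow> x $ i = p $ i"
      using that by (auto simp: subsquare_def)
    then have "x = p + axis j (x $ j - p $ j) + axis l (x $ l - p $ l)"
      "x $ j - p $ j \<in> {0, 1}" "x $ l - p $ l \<in> {0, 1}"
      using assms by (auto simp: vec_eq_iff axis_def)
    moreover have "axis i (0 :: 4) = 0" for i :: 'a
      by (simp add: vec_eq_iff axis_def)
    ultimately show ?thesis
      by fastforce
  qed
  then have "subsquare j l p = {p, p + axis j 1, p + axis l 1, p + axis j 1 + axis l 1}"
    using assms by (auto simp: subsquare_def axis_def)
  moreover have "p \<noteq> p + axis j 1" "p \<noteq> p + axis l 1" "p + axis j 1 \<noteq> p + axis l 1"
      "p \<noteq> p + axis j 1 + axis l 1" "p + axis j 1 \<noteq> p + axis j 1 + axis l 1"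
      "p + axis l 1 \<noteq> p + axis j 1 + axis l 1"
    using assms by (auto simp: vec_eq_iff axis_def)
  ultimately show ?thesis
    by (simp add: ac_simps)
qed

text \<open>Vanishing mixed differences extend from unit steps to arbitrary steps by one induction
  for each of the two axes. The point \<open>x\<close> is then built up from the origin one
  coordinate at a time.\<close>

lemma additively_separated:
  fixes h :: "4 ^ 'm::finite \<Rightarrow> real"
  assumes mixed: "\<And>j l p. j \<noteq> l \<Longrightarrow>
      h (p + axis j 1 + axis l 1) = h (p + axis j 1) + h (p + axis l 1) - h p"
  shows "h x = h 0 + (\<Sum>j\<in>UNIV. h (axis j (x $ j)) - h 0)"
proof -
  have axis_Suc: "axis i (of_nat (Suc n)) = axis i (of_nat n) + axis i (1 :: 4)" for i :: 'm and n
    by (simp add: axis_add add.commute)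
  have axis_0: "axis i (0 :: 4) = 0" for i :: 'm
    by (simp add: vec_eq_iff axis_def)
  have mixed1: "h (p + axis j 1 + axis l (of_nat n)) = h (p + axis j 1) + h (p + axis l (of_nat n)) - h p"
    if "j \<noteq> l" for j l p n
  proof (induction n)
    case 0
    show ?case by (simp add: axis_0)
  next
    case (Suc n)
    have "h (p + axis j 1 + axis l (of_nat (Suc n))) = h ((p + axis l (of_nat n)) + axis j 1 + axis l 1)"
      unfolding axis_Suc by (simp add: ac_simps)
    also have "\<dots> = h (p + axis j 1 + axis l (of_nat n)) + h (p + axis l (of_nat (Suc n)))
        - h (p + axis l (of_nat n))"
      unfolding mixed[OF that] axis_Suc by (simp add: ac_simps)
    finally show ?case
      using Suc.IH by simp
  qed
  have mixed2: "h (p + axis j (of_nat k) + axis l (of_nat n))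
      = h (p + axis j (of_nat k)) + h (p + axis l (of_nat n)) - h p" if "j \<noteq> l" for j l p k n
  proof (induction k)
    case 0
    show ?case by (simp add: axis_0)
  next
    case (Suc k)
    have "h (p + axis j (of_nat (Suc k)) + axis l (of_nat n))
        = h ((p + axis j (of_nat k)) + axis j 1 + axis l (of_nat n))"
      unfolding axis_Suc by (simp add: ac_simps)
    also have "\<dots> = h (p + axis j (of_nat (Suc k))) + h (p + axis j (of_nat k) + axis l (of_nat n))
        - h (p + axis j (of_nat k))"
      unfolding mixed1[OF that] axis_Suc by (simp add: ac_simps)
    finally show ?case
      using Suc.IH by simp
  qed
  have of_nat: "\<exists>n. t = of_nat n" for t :: 4
    using Z4_cases[of t] by (metis of_nat_0 of_nat_1 of_nat_numeral)
  have mixed3: "h (p + axis j s + axis l t) = h (p + axis j s) + h (p + axis l t) - h p"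
    if "j \<noteq> l" for j l p s t
    using of_nat[of s] of_nat[of t] mixed2[OF that] by auto
  \<comment> \<open>\<open>R L\<close> agrees with \<open>x\<close> on \<open>L\<close> and is 0
    elsewhere; by \<open>step\<close>, a move along a new axis changes \<open>h\<close> by the same
    amount at \<open>R L\<close> as at the origin.\<close>
  define R where "R L = (\<Sum>l\<in>L. axis l (x $ l))" for L
  have step: "h (R L + axis j t) = h (R L) + h (axis j t) - h 0" if "finite L" "j \<notin> L" for L j t
    using that
  proof (induction L)
    case empty
    then show ?case by (simp add: R_def)
  next
    case (insert l L)
    then have "h (R (insert l L) + axis j t) = h (R L + axis l (x $ l) + axis j t)"
      by (simp add: R_def ac_simps)
    also have "\<dots> = h (R L + axis l (x $ l)) + h (R L + axis j t) - h (R L)"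
      using insert by (intro mixed3) auto
    finally show ?case
      using insert by (simp add: R_def ac_simps)
  qed
  have "h (R L) = h 0 + (\<Sum>j\<in>L. h (axis j (x $ j)) - h 0)" if "finite L" for L
    using that
  proof (induction L)
    case empty
    then show ?case by (simp add: R_def)
  next
    case (insert l L)
    then have "h (R (insert l L)) = h (R L + axis l (x $ l))"
      by (simp add: R_def ac_simps)
    then show ?case
      using insert step[of L l "x $ l"] by simp
  qed
  moreover have "R UNIV = x"
    by (simp add: R_def vec_eq_iff axis_def)
  ultimately show ?thesis
    by (metis finite)
qed

text \<open>
  The functions on the integers modulo 4 with \<open>a (t + 2) = - a t\<close> are spanned by \<open>sig\<close> and
  \<open>tau\<close>. In this basis (rather than the unit vectors) a wave is a sum with coefficients 1 and \<open>-1\<close>.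
\<close>

definition sig :: "4 \<Rightarrow> real" where
  "sig t = (if t \<in> {0, 1} then 1 else -1)"

definition tau :: "4 \<Rightarrow> real" where
  "tau t = (if t \<in> {0, 3} then 1 else -1)"

text \<open>This is \<open>(-1) ^ t\<close>. The factorisation into \<open>sig\<close> and
  \<open>tau\<close> is what gives \<open>sign_vector x\<close> the sign product 1.\<close>

definition par :: "4 \<Rightarrow> real" where
  "par t = sig t * tau t"

definition eps :: "4 ^ 'm \<Rightarrow> real" where
  "eps x = (\<Prod>j\<in>UNIV. par (x $ j))"

text \<open>The index type \<open>('m + 'm) option\<close> provides the \<open>2 m + 1\<close>
  weights: \<open>None\<close> for the constant, \<open>Inl j\<close> and \<open>Inr j\<close> for
  the two coefficients at coordinate \<open>j\<close>.\<close>

definition profile :: "(('m + 'm) option \<Rightarrow> real) \<Rightarrow> 'm \<Rightarrow> 4 \<Rightarrow> real" where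
  "profile w j t = sig t * w (Some (Inl j)) + tau t * w (Some (Inr j))"

definition wave :: "(('m + 'm) option \<Rightarrow> real) \<Rightarrow> 4 ^ 'm \<Rightarrow> real" where
  "wave w x = eps x * (w None + (\<Sum>j\<in>UNIV. profile w j (x $ j)))"

lemma par_add: "par (s + t) = par s * par t"
  using Z4_cases[of s] Z4_cases[of t] by (elim disjE) (simp_all add: par_def sig_def tau_def)

lemma profile_antiperiodic: "profile w j (t + 2) = - profile w j t"
  using Z4_cases[of t] by (elim disjE) (simp_all add: profile_def sig_def tau_def)

lemma eps_add: "eps (x + y) = eps x * eps y"
  by (simp add: eps_def par_add prod.distrib)

lemma eps_axis: "eps (axis j t) = par t"
proof -
  have "eps (axis j t) = (\<Prod>i\<in>UNIV. if i = j then par t else 1)"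
    unfolding eps_def by (rule prod.cong) (auto simp: axis_def par_def sig_def tau_def)
  then show ?thesis
    by simp
qed

lemma par_cases: "par t = 1 \<or> par t = -1"
  by (simp add: par_def sig_def tau_def)

lemma eps_cases: "eps x = 1 \<or> eps x = -1"
proof -
  have "(\<Prod>j\<in>UNIV. par (x $ j)) \<in> {1, -1}"
    by (rule prod_signs_cases) (use par_cases in auto)
  then show ?thesis
    by (simp add: eps_def)
qed

lemma wave_shift:
  "wave w (p + axis j t) = par t * eps p *
    (w None + (\<Sum>i\<in>UNIV. profile w i (p $ i)) + profile w j (p $ j + t) - profile w j (p $ j))"
proof -
  have "(\<Sum>i\<in>UNIV. profile w i ((p + axis j t) $ i))
      = profile w j (p $ j + t) + (\<Sum>i\<in>UNIV - {j}. profile w i (p $ i))"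
    by (subst sum.remove[of _ j]) (auto simp: axis_def intro!: sum.cong)
  moreover have "(\<Sum>i\<in>UNIV. profile w i (p $ i))
      = profile w j (p $ j) + (\<Sum>i\<in>UNIV - {j}. profile w i (p $ i))"
    by (subst sum.remove[of _ j]) auto
  ultimately show ?thesis
    by (simp add: wave_def eps_add eps_axis)
qed

section \<open>Waves as the solutions of the homogeneous magic conditions\<close>

text \<open>The conditions on entries diminished by \<open>S / 4\<close>, with lines and subsquares
  parametrised by shifts of a base point.\<close>

definition null_magic :: "(4 ^ 'm \<Rightarrow> real) \<Rightarrow> bool" where
  "null_magic g \<longleftrightarrow> (\<forall>j p. (\<Sum>t\<in>UNIV. g (p + axis j t)) = 0) \<and>
    (\<forall>j l p. j \<noteq> l \<longrightarrow>
      g p + g (p + axis j 1) + g (p + axis l 1) + g (p + axis j 1 + axis l 1) = 0)"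

text \<open>On a line, \<open>par\<close> alternates, which cancels everything constant, and the
  steps \<open>t\<close> and \<open>t + 2\<close> carry equal signs but opposite profiles. On a
  subsquare, a unit step along \<open>j\<close> flips \<open>eps\<close> and leaves the profile
  increment along \<open>l\<close> unchanged.\<close>

lemma null_magic_wave: "null_magic (wave w)"
  unfolding null_magic_def
proof (intro conjI allI impI)
  fix j p
  have p: "profile w j (p $ j + 2) = - profile w j (p $ j)"
      "profile w j (p $ j + 3) = - profile w j (p $ j + 1)"
    using profile_antiperiodic[of w j "p $ j"] profile_antiperiodic[of w j "p $ j + 1"]
    by (simp_all add: add.assoc)
  show "(\<Sum>t\<in>UNIV. wave w (p + axis j t)) = 0"
    unfolding sum_Z4 wave_shift p by (simp add: par_def sig_def tau_def algebra_simps)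
next
  fix j l :: 'a and p assume "j \<noteq> l"
  have shift: "wave w (q + axis i 1)
      = - (wave w q + eps q * (profile w i (q $ i + 1) - profile w i (q $ i)))" for i q
    unfolding wave_shift by (simp add: wave_def par_def sig_def tau_def algebra_simps)
  have "eps (p + axis j 1) = - eps p"
    by (simp add: eps_add eps_axis par_def sig_def tau_def)
  moreover have "(p + axis j 1) $ l = p $ l"
    using \<open>j \<noteq> l\<close> by (simp add: axis_def)
  ultimately show "wave w p + wave w (p + axis j 1) + wave w (p + axis l 1)
      + wave w (p + axis j 1 + axis l 1) = 0"
    using shift[of "p + axis j 1" l] shift[of p l] by simp
qed

text \<open>Multiplication by \<open>eps\<close> turns subsquare sums into mixed second differences,
  so \<open>h\<close> separates. The lines through the origin give
  \<open>\<beta> j 0 + \<beta> j 2 = \<beta> j 1 + \<beta> j 3\<close>, so subtracting the common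
  half-sum \<open>\<mu> j\<close> leaves an antiperiodic function.\<close>

lemma null_magic_imp_wave:
  assumes "null_magic g"
  shows "\<exists>w. g = wave w"
proof -
  define h where "h x = eps x * g x" for x
  have g: "g x = eps x * h x" for x
    using eps_cases[of x] by (auto simp: h_def)
  have axis_0: "axis j (0 :: 4) = 0" for j :: 'a
    by (simp add: vec_eq_iff axis_def)
  have par: "par 0 = 1" "par 1 = -1" "par 2 = 1" "par 3 = -1"
    by (simp_all add: par_def sig_def tau_def)
  have sep: "h x = h 0 + (\<Sum>j\<in>UNIV. h (axis j (x $ j)) - h 0)" for x
  proof (rule additively_separated)
    fix j l :: 'a and p assume "j \<noteq> l"
    then have "g p + g (p + axis j 1) + g (p + axis l 1) + g (p + axis j 1 + axis l 1) = 0"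
      using assms by (simp add: null_magic_def)
    then have "eps p * (h p - h (p + axis j 1) - h (p + axis l 1) + h (p + axis j 1 + axis l 1)) = 0"
      unfolding g by (simp add: eps_add eps_axis par algebra_simps)
    then show "h (p + axis j 1 + axis l 1) = h (p + axis j 1) + h (p + axis l 1) - h p"
      using eps_cases[of p] by auto
  qed
  define \<beta> where "\<beta> j t = h (axis j t)" for j t
  have line: "\<beta> j 0 - \<beta> j 1 + \<beta> j 2 - \<beta> j 3 = 0" for j
  proof -
    have "(\<Sum>t\<in>UNIV. g (0 + axis j t)) = 0"
      using assms unfolding null_magic_def by blast
    then show ?thesis
      unfolding g sum_Z4 by (simp add: eps_axis par \<beta>_def)
  qed
  define \<mu> where "\<mu> j = (\<beta> j 0 + \<beta> j 2) / 2" for j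
  \<comment> \<open>The coefficients are the inner products of \<open>\<beta> j\<close> with the
    orthogonal functions \<open>sig\<close> and \<open>tau\<close>, divided by 4;
    \<open>None\<close> collects all constants.\<close>
  define w where "w i = (case i of None \<Rightarrow> h 0 + (\<Sum>j\<in>UNIV. \<mu> j - h 0)
      | Some (Inl j) \<Rightarrow> (\<beta> j 0 + \<beta> j 1 - \<beta> j 2 - \<beta> j 3) / 4
      | Some (Inr j) \<Rightarrow> (\<beta> j 0 - \<beta> j 1 - \<beta> j 2 + \<beta> j 3) / 4)" for i
  have profile: "profile w j t = \<beta> j t - \<mu> j" for j t
    using Z4_cases[of t] line[of j]
    by (elim disjE) (simp_all add: profile_def w_def \<mu>_def sig_def tau_def field_simps)
  have "wave w x = g x" for x
  proof -
    have "wave w x = eps x * (h 0 + (\<Sum>j\<in>UNIV. \<mu> j - h 0) + (\<Sum>j\<in>UNIV. \<beta> j (x $ j) - \<mu> j))"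
      by (simp add: wave_def profile) (simp add: w_def)
    also have "(h 0 + (\<Sum>j\<in>UNIV. \<mu> j - h 0) + (\<Sum>j\<in>UNIV. \<beta> j (x $ j) - \<mu> j)) = h x"
      unfolding sep[of x] \<beta>_def by (simp add: sum_subtractf)
    finally show ?thesis
      by (simp add: g)
  qed
  then show ?thesis
    by (intro exI[of _ w]) (simp add: fun_eq_iff)
qed

text \<open>The weights are read off from the values at the origin and at the steps 1 and 2 along
  each axis.\<close>

lemma inj_wave: "inj wave"
proof (rule injI)
  fix w w' :: "('a + 'a) option \<Rightarrow> real"
  assume eq: "wave w = wave w'"
  have wave_axis: "wave v (axis j t) = par t * (wave v 0 + profile v j t - profile v j 0)"
    for v :: "('a + 'a) option \<Rightarrow> real" and j t
    using wave_shift[of v 0 j t] wave_def[of v 0] by (simp add: eps_def par_def sig_def tau_def)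
  have Inr: "v (Some (Inr j)) = (wave v 0 + wave v (axis j 1)) / 2"
    for v :: "('a + 'a) option \<Rightarrow> real" and j
    unfolding wave_axis by (simp add: profile_def par_def sig_def tau_def)
  have Inl: "v (Some (Inl j)) = (wave v 0 - wave v (axis j 2)) / 2 - v (Some (Inr j))"
    for v :: "('a + 'a) option \<Rightarrow> real" and j
    unfolding wave_axis by (simp add: field_simps profile_def par_def sig_def tau_def)
  have None: "v None = wave v 0 - (\<Sum>j\<in>UNIV. profile v j 0)"
    for v :: "('a + 'a) option \<Rightarrow> real"
    by (simp add: wave_def eps_def par_def sig_def tau_def)
  have Some: "w (Some i) = w' (Some i)" for i
    by (cases i) (simp_all only: Inl Inr eq)
  then have "w None = w' None"
    unfolding None profile_def by (simp add: eq)
  then show "w = w'"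
    using Some by (metis ext option.exhaust)
qed

text \<open>The shift by 2 in every coordinate preserves \<open>eps\<close> and negates every
  profile, so only the constant weight survives.\<close>

lemma wave_antipodal:
  fixes x :: "4 ^ 'm"
  shows "wave w x + wave w (x + (\<chi> i. 2)) = 2 * eps x * w None"
proof -
  have "eps ((\<chi> i. 2) :: 4 ^ 'm) = 1"
    by (simp add: eps_def par_def sig_def tau_def)
  then show ?thesis
    by (simp add: wave_def eps_add profile_antiperiodic sum_negf algebra_simps)
qed

lemma compact_magic_with_iff:
  "compact_magic_with S f \<longleftrightarrow> arrangement f \<and> null_magic (\<lambda>x. real (f x) - real S / 4)"
proof -
  have "(\<Sum>x\<in>orthogonal_line j p. f x) = S \<longleftrightarrow> (\<Sum>t\<in>UNIV. real (f (p + axis j t)) - real S / 4) = 0"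
    for j p
    unfolding sum_orthogonal_line sum_Z4 by (simp add: algebra_simps flip: of_nat_eq_iff[where 'a = real])
  moreover have "(\<Sum>x\<in>subsquare j l p. f x) = S \<longleftrightarrow>
      (real (f p) - real S / 4) + (real (f (p + axis j 1)) - real S / 4)
      + (real (f (p + axis l 1)) - real S / 4) + (real (f (p + axis j 1 + axis l 1)) - real S / 4) = 0"
    if "j \<noteq> l" for j l p
    unfolding sum_subsquare[OF that] by (simp add: algebra_simps flip: of_nat_eq_iff[where 'a = real])
  ultimately show ?thesis
    unfolding compact_magic_with_def null_magic_def by simp
qed

text \<open>Double counting: summed over all base points, the lines in one fixed direction cover
  each entry four times.\<close>

lemma magic_constant:
  fixes f :: "4 ^ 'm::finite \<Rightarrow> nat"
  assumes "compact_magic_with S f"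
  shows "S = 2 * (4 ^ CARD('m) + 1)"
proof -
  let ?N = "4 ^ CARD('m) :: nat"
  \<comment> \<open>A direction exists since types are nonempty, which is the condition that the
    dimension is at least 1.\<close>
  fix j :: 'm
  have shift: "(\<Sum>x\<in>UNIV. f (x + a)) = sum f UNIV" for a
  proof -
    have "bij (\<lambda>x. x + a)"
      by (rule bij_betw_byWitness[where f' = "\<lambda>x. x - a"]) auto
    then show ?thesis
      by (rule sum.reindex_bij_betw)
  qed
  have "?N * S = (\<Sum>x\<in>(UNIV :: (4 ^ 'm) set). S)"
    by simp
  also have "\<dots> = (\<Sum>x\<in>UNIV. \<Sum>t\<in>UNIV. f (x + axis j t))"
    using assms by (intro sum.cong) (simp_all add: compact_magic_with_def sum_orthogonal_line)
  also have "\<dots> = (\<Sum>t\<in>(UNIV :: 4 set). sum f UNIV)"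
    by (subst sum.swap) (simp add: shift)
  also have "\<dots> = 4 * sum f UNIV"
    by simp
  also have "sum f UNIV = \<Sum>{1..?N}"
    using assms unfolding compact_magic_with_def arrangement_def
    by (auto intro: sum.reindex_bij_betw[where g = "\<lambda>x. x"])
  also have "4 * \<Sum>{1..?N} = 2 * (?N * (?N + 1))"
  proof -
    have "2 * \<Sum>{1..n} = n * (n + 1)" for n :: nat
      by (induction n) auto
    from this[of ?N] show ?thesis
      by linarith
  qed
  finally have "?N * S = ?N * (2 * (?N + 1))"
    by (simp only: mult.left_commute)
  moreover have "?N \<noteq> 0"
    by simp
  ultimately show ?thesis
    by (metis mult_left_cancel)
qed

subsection \<open>Labelings and weights\<close>

definition sign_vector :: "4 ^ 'm \<Rightarrow> ('m + 'm) option \<Rightarrow> real" where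
  "sign_vector x i = eps x * (case i of None \<Rightarrow> 1
      | Some (Inl j) \<Rightarrow> sig (x $ j) | Some (Inr j) \<Rightarrow> tau (x $ j))"

lemma wave_eq_signed_sum: "wave w x = (\<Sum>i\<in>UNIV. sign_vector x i * w i)"
  by (simp add: wave_def profile_def sum_UNIV_option_sum sign_vector_def sum.distrib
      sum_distrib_left algebra_simps)

text \<open>Multiplying by the \<open>None\<close> entry strips off \<open>eps\<close> and leaves
  the pairs \<open>(sig t, tau t)\<close>, which encode the four residues bijectively as pairs of
  signs. Sign product 1 says precisely that the \<open>None\<close> entry equals \<open>eps\<close>
  of the decoded point.\<close>

lemma bij_sign_vector: "bij_betw (sign_vector :: 4 ^ 'm::finite \<Rightarrow> _) UNIV balanced_signs"
proof (rule bij_betw_byWitness)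
  define quad :: "real \<Rightarrow> real \<Rightarrow> 4" where
    "quad a b = (if a = 1 then if b = 1 then 0 else 1 else if b = 1 then 3 else 2)" for a b
  define decode :: "(('m + 'm) option \<Rightarrow> real) \<Rightarrow> 4 ^ 'm" where
    "decode s = (\<chi> j. quad (s None * s (Some (Inl j))) (s None * s (Some (Inr j))))" for s
  have quad: "quad (sig t) (tau t) = t" for t
    using Z4_cases[of t] by (elim disjE) (simp_all add: quad_def sig_def tau_def)
  have sig_quad: "sig (quad a b) = a" "tau (quad a b) = b" if "a \<in> {1, -1}" "b \<in> {1, -1}" for a b
    using that by (auto simp: quad_def sig_def tau_def)
  have eps_sq: "eps x * (eps x * c) = c" for x :: "4 ^ 'm" and c
    using eps_cases[of x] by auto
  show "\<forall>x\<in>UNIV. decode (sign_vector x) = x"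
    by (simp add: decode_def sign_vector_def eps_sq quad vec_eq_iff)
  show "\<forall>s\<in>balanced_signs. sign_vector (decode s) = s"
  proof
    fix s :: "('m + 'm) option \<Rightarrow> real" assume s: "s \<in> balanced_signs"
    have sgn: "s i \<in> {1, -1}" for i
      using s by (simp add: balanced_signs_def)
    have sq: "s None * (s None * c) = c" for c
      using sgn[of None] by auto
    have "s None * s (Some i) \<in> {1, -1}" for i
      using sgn[of None] sgn[of "Some i"] by auto
    then have sig_decode: "sig (decode s $ j) = s None * s (Some (Inl j))"
        "tau (decode s $ j) = s None * s (Some (Inr j))" for j
      by (simp_all only: decode_def vec_lambda_beta sig_quad)
    have "eps (decode s) = (\<Prod>j\<in>UNIV. s (Some (Inl j)) * s (Some (Inr j)))"
      unfolding eps_def by (rule prod.cong) (simp_all add: par_def sig_decode sq mult.assoc mult.left_commute)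
    moreover have "s None * (\<Prod>j\<in>UNIV. s (Some (Inl j)) * s (Some (Inr j))) = 1"
      using s by (simp add: balanced_signs_def prod_UNIV_option_sum prod.distrib mult.assoc)
    ultimately have eps: "eps (decode s) = s None"
      using sgn[of None] by auto
    show "sign_vector (decode s) = s"
      by (auto simp: fun_eq_iff sign_vector_def eps sig_decode sq split: option.split sum.split)
  qed
  have "sign_vector x \<in> balanced_signs" for x :: "4 ^ 'm"
  proof -
    have "sign_vector x i \<in> {1, -1}" for i
      using eps_cases[of x] by (auto simp: sign_vector_def sig_def tau_def split: option.split sum.split)
    moreover have "prod (sign_vector x) UNIV
        = eps x * (\<Prod>j\<in>UNIV. eps x * sig (x $ j) * (eps x * tau (x $ j)))"
      by (simp add: prod_UNIV_option_sum sign_vector_def prod.distrib power_add)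
    moreover have "(\<Prod>j\<in>UNIV. eps x * sig (x $ j) * (eps x * tau (x $ j))) = eps x"
    proof -
      have "eps x * sig t * (eps x * tau t) = par t" for t
        using eps_cases[of x] by (auto simp: par_def)
      then show ?thesis
        by (simp add: eps_def)
    qed
    ultimately show ?thesis
      using eps_cases[of x] by (auto simp: balanced_signs_def)
  qed
  then show "sign_vector ` (UNIV :: (4 ^ 'm) set) \<subseteq> balanced_signs"
    by blast
  show "decode ` balanced_signs \<subseteq> UNIV"
    by simp
qed

lemma bij_wave_iff:
  fixes w :: "('m::finite + 'm) option \<Rightarrow> real"
  shows "bij_betw (wave w) UNIV (centered (4 ^ CARD('m))) \<longleftrightarrow>
    bij_betw (\<lambda>i. \<bar>w i\<bar>) UNIV (insert 0 (half_powers (2 * CARD('m))))"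
proof -
  have "bij_betw (\<lambda>s. \<Sum>i\<in>UNIV. s i * w i) balanced_signs (centered (4 ^ CARD('m))) \<longleftrightarrow>
      bij_betw ((\<lambda>s. \<Sum>i\<in>UNIV. s i * w i) \<circ> sign_vector) UNIV (centered (4 ^ CARD('m)))"
    by (rule bij_betw_comp_iff[OF bij_sign_vector])
  also have "(\<lambda>s. \<Sum>i\<in>UNIV. s i * w i) \<circ> sign_vector = wave w"
    by (simp add: fun_eq_iff wave_eq_signed_sum)
  finally show ?thesis
    using balanced_sums_iff[of "2 * CARD('m)" w] by (simp add: power_mult)
qed

text \<open>Entries start at 1 while \<open>centered\<close> counts from 0, hence
  \<open>N + 1\<close> here in place of \<open>N - 1\<close>.\<close>

lemma shifted_labels: "(\<lambda>k. real k - (real N + 1) / 2) ` {1..N} = centered N"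
proof -
  have "{1..N} = Suc ` {..<N}"
    by (simp add: image_Suc_lessThan)
  then show ?thesis
    by (simp add: centered_def image_image field_simps)
qed

lemma arrangement_iff:
  fixes f :: "4 ^ 'm::finite \<Rightarrow> nat"
  shows "arrangement f \<longleftrightarrow>
    bij_betw (\<lambda>x. real (f x) - (real (4 ^ CARD('m)) + 1) / 2) UNIV (centered (4 ^ CARD('m)))"
proof -
  have "inj (\<lambda>k. real k - (real (4 ^ CARD('m)) + 1) / 2)"
    by (simp add: inj_def)
  from bij_betw_comp_image_iff[OF this, of f UNIV "{1..4 ^ CARD('m)}"] show ?thesis
    unfolding arrangement_def shifted_labels by blast
qed

definition weights :: "(('m + 'm) option \<Rightarrow> real) set" where
  "weights = {w. bij_betw (\<lambda>i. \<bar>w i\<bar>) UNIV (insert 0 (half_powers (2 * CARD('m))))}"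

text \<open>Rounding merely returns to type \<open>nat\<close>: for \<open>w \<in> weights\<close>
  the rounded number is already a natural number, by \<open>real_labeling\<close>.\<close>

definition labeling :: "(('m + 'm) option \<Rightarrow> real) \<Rightarrow> 4 ^ 'm \<Rightarrow> nat" where
  "labeling w x = nat \<lfloor>wave w x + (real (4 ^ CARD('m)) + 1) / 2\<rfloor>"

lemma real_labeling:
  fixes w :: "('m::finite + 'm) option \<Rightarrow> real"
  assumes "w \<in> weights"
  shows "real (labeling w x) = wave w x + (real (4 ^ CARD('m)) + 1) / 2"
proof -
  have "bij_betw (wave w) UNIV (centered (4 ^ CARD('m)))"
    using assms by (simp add: weights_def bij_wave_iff)
  then have "wave w x \<in> centered (4 ^ CARD('m))"
    by (auto dest: bij_betwE)
  then obtain k :: nat where "wave w x = real k - (real (4 ^ CARD('m)) + 1) / 2"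
    unfolding shifted_labels[symmetric] by auto
  then show ?thesis
    by (simp add: labeling_def)
qed

text \<open>The magic constant fixes the mean, so the centred entries form a wave; being an
  arrangement then becomes the condition on absolute values that defines
  \<open>weights\<close>.\<close>

lemma compact_magic_with_iff_labeling:
  fixes f :: "4 ^ 'm::finite \<Rightarrow> nat"
  shows "compact_magic_with S f \<longleftrightarrow> S = 2 * (4 ^ CARD('m) + 1) \<and> (\<exists>w\<in>weights. f = labeling w)"
proof (cases "S = 2 * (4 ^ CARD('m) + 1)")
  case True
  let ?g = "\<lambda>x. real (f x) - (real (4 ^ CARD('m)) + 1) / 2"
  have "real S / 4 = (real (4 ^ CARD('m)) + 1) / 2"
    using True by simp
  then have "compact_magic_with S f \<longleftrightarrow> arrangement f \<and> null_magic ?g"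
    by (simp only: compact_magic_with_iff)
  also have "\<dots> \<longleftrightarrow> bij_betw ?g UNIV (centered (4 ^ CARD('m))) \<and> (\<exists>w. ?g = wave w)"
    unfolding arrangement_iff using null_magic_imp_wave null_magic_wave by metis
  also have "\<dots> \<longleftrightarrow> (\<exists>w\<in>weights. ?g = wave w)"
    unfolding weights_def bij_wave_iff[symmetric] by auto
  also have "\<dots> \<longleftrightarrow> (\<exists>w\<in>weights. f = labeling w)"
  proof (rule bex_cong[OF refl])
    fix w :: "('m + 'm) option \<Rightarrow> real" assume "w \<in> weights"
    then have "?g x = wave w x \<longleftrightarrow> f x = labeling w x" for x
      using real_labeling[of w x] by (auto simp flip: of_nat_eq_iff[where 'a = real])
    then show "?g = wave w \<longleftrightarrow> f = labeling w"
      by (simp add: fun_eq_iff)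
  qed
  finally show ?thesis
    using True by simp
next
  case False
  then show ?thesis
    using magic_constant by blast
qed

lemma compact_magic_hypercubes:
  "{f :: 4 ^ 'm::finite \<Rightarrow> nat. compact_magic_hypercube f} = labeling ` weights"
  by (auto simp: compact_magic_hypercube_def compact_magic_with_iff_labeling)

section \<open>Most-perfect labelings\<close>

text \<open>Modulo 4, both \<open>2 * 1\<close> and \<open>2 * (-1)\<close> equal 2, so two steps in
  any diagonal direction lead to the same antipode. A pandiagonal splits into two antipodal pairs,
  so its sum follows from the pair condition.\<close>

lemma most_perfect_with_iff:
  fixes f :: "4 ^ 'm::finite \<Rightarrow> nat"
  shows "most_perfect_with S f \<longleftrightarrow>
    compact_magic_with S f \<and> (\<forall>x. 2 * (f x + f (x + (\<chi> i. 2))) = S)"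
proof -
  have antipode: "p + (t + 2) *s d = p + t *s d + (\<chi> i. 2)" if "d \<in> diagonal_directions"
    for p d :: "4 ^ 'm" and t
  proof -
    have "2 * d $ i = 2" for i
      using that by (auto simp: diagonal_directions_def dest!: spec[of _ i])
    then show ?thesis
      by (simp add: vec_eq_iff distrib_right)
  qed
  have sum_diagonal: "sum f (great_pandiagonal p d) = (\<Sum>t\<in>UNIV. f (p + t *s d))"
    if "d \<in> diagonal_directions" for p d
  proof -
    fix j :: 'm
    have "d $ j = 1 \<or> d $ j = -1"
      using that by (auto simp: diagonal_directions_def)
    then have "inj (\<lambda>t. p + t *s d)"
      by (auto simp: inj_def vec_eq_iff dest!: spec[of _ j])
    moreover have "great_pandiagonal p d = range (\<lambda>t. p + t *s d)"
      by (auto simp: great_pandiagonal_def)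
    ultimately show ?thesis
      by (simp add: sum.reindex)
  qed
  have one: "(\<chi> i. 1) \<in> (diagonal_directions :: (4 ^ 'm) set)"
    by (simp add: diagonal_directions_def)
  have "2 * (f x + f (x + (\<chi> i. 2))) = S" if "most_perfect_with S f" for x
  proof -
    have "2 * (f (x + 0 *s (\<chi> i. 1)) + f (x + (0 + 2) *s (\<chi> i. 1))) = S"
      using that one unfolding most_perfect_with_def by blast
    then show ?thesis
      unfolding antipode[OF one] by simp
  qed
  moreover have "most_perfect_with S f"
    if "compact_magic_with S f" and pairs: "\<And>x. 2 * (f x + f (x + (\<chi> i. 2))) = S"
  proof -
    have half_sums: "a + b + a' + b' = S" if "2 * (a + a') = S" "2 * (b + b') = S" for a a' b b' :: nat
      using that by simp
    have "sum f (great_pandiagonal p d) = S" if d: "d \<in> diagonal_directions" for p d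
    proof -
      have "f (p + 2 *s d) = f (p + 0 *s d + (\<chi> i. 2))" "f (p + 3 *s d) = f (p + 1 *s d + (\<chi> i. 2))"
        using antipode[OF d, of p 0] antipode[OF d, of p 1] by (simp_all add: add.assoc)
      then show ?thesis
        using half_sums[OF pairs pairs, of "p + 0 *s d" "p + 1 *s d"]
        unfolding sum_diagonal[OF d] sum_Z4 by simp
    qed
    then show ?thesis
      using that by (simp add: most_perfect_with_def antipode)
  qed
  ultimately show ?thesis
    by (auto simp: most_perfect_with_def)
qed

text \<open>By \<open>wave_antipodal\<close>, an antipodal pair misses half the magic constant by
  \<open>2 * eps x * w None\<close>. As \<open>eps x\<close> is a sign, the condition at each single
  \<open>x\<close> is already \<open>w None = 0\<close>.\<close>

lemma most_perfect_magic_hypercubes: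
  "{f :: 4 ^ 'm::finite \<Rightarrow> nat. most_perfect_magic_hypercube f} = labeling ` {w \<in> weights. w None = 0}"
proof -
  have halves: "a + M / 2 + (b + M / 2) = M \<longleftrightarrow> a + b = 0" for a b M :: real
    by (auto simp: field_simps)
  have "(\<forall>x. 2 * (labeling w x + labeling w (x + (\<chi> i. 2))) = 2 * (4 ^ CARD('m) + 1)) \<longleftrightarrow> w None = 0"
    if w: "w \<in> weights" for w :: "('m + 'm) option \<Rightarrow> real"
  proof -
    have "2 * (labeling w x + labeling w (x + (\<chi> i. 2))) = 2 * (4 ^ CARD('m) + 1) \<longleftrightarrow> w None = 0" for x
    proof -
      have "2 * (labeling w x + labeling w (x + (\<chi> i. 2))) = 2 * (4 ^ CARD('m) + 1) \<longleftrightarrow>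
          real (labeling w x) + real (labeling w (x + (\<chi> i. 2))) = real (4 ^ CARD('m)) + 1"
      proof -
        have "real (a + b) = real (c + 1) \<longleftrightarrow> 2 * (a + b) = 2 * (c + 1)" for a b c :: nat
          unfolding of_nat_eq_iff by auto
        then show ?thesis
          by (simp only: of_nat_add of_nat_1)
      qed
      also have "\<dots> \<longleftrightarrow> 2 * eps x * w None = 0"
        unfolding real_labeling[OF w] wave_antipodal[symmetric] by (rule halves)
      also have "\<dots> \<longleftrightarrow> w None = 0"
        using eps_cases[of x] by auto
      finally show ?thesis .
    qed
    then show ?thesis
      by simp
  qed
  then show ?thesis
    by (auto simp: most_perfect_magic_hypercube_def most_perfect_with_iff compact_magic_with_iff_labeling)
qed

lemma inj_on_labeling: "inj_on labeling (weights :: (('m::finite + 'm) option \<Rightarrow> real) set)"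
proof (rule inj_onI)
  fix w w' :: "('m + 'm) option \<Rightarrow> real"
  assume "w \<in> weights" "w' \<in> weights" "labeling w = labeling w'"
  then have "wave w x = wave w' x" for x
    using real_labeling[of w x] real_labeling[of w' x] by simp
  then show "w = w'"
    by (intro injD[OF inj_wave] ext)
qed

section \<open>Counting the weight families\<close>

lemma half_powers_facts:
  "finite (half_powers n)" "card (half_powers n) = n" "0 \<notin> half_powers n"
  "p \<in> half_powers n \<Longrightarrow> 0 \<le> p"
proof -
  have "inj (\<lambda>k. 2 ^ k / 2 :: real)"
    by (auto intro!: injI)
  then show "card (half_powers n) = n"
    by (simp add: half_powers_def card_image inj_on_subset)
qed (auto simp: half_powers_def)

lemma card_weights:
  "card (weights :: (('m::finite + 'm) option \<Rightarrow> real) set) = 4 ^ CARD('m) * fact (2 * CARD('m) + 1)"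
proof -
  let ?P = "insert 0 (half_powers (2 * CARD('m)))"
  have "card (weights :: (('m + 'm) option \<Rightarrow> real) set)
      = fact CARD(('m + 'm) option) * 2 ^ card (?P - {0})"
    unfolding weights_def by (rule card_abs_bij_UNIV) (use half_powers_facts in auto)
  also have "CARD(('m + 'm) option) = 2 * CARD('m) + 1"
    by simp
  also have "(2 :: nat) ^ card (?P - {0}) = 4 ^ CARD('m)"
    by (simp add: half_powers_facts power_mult)
  finally show ?thesis
    by (simp only: mult.commute)
qed

text \<open>With the constant weight equal to 0, the other \<open>2 m\<close> weights have exactly
  the half powers as absolute values; all of these are nonzero, so every sign is free.\<close>

lemma card_weights_vanishing:
  "card {w :: ('m::finite + 'm) option \<Rightarrow> real. w \<in> weights \<and> w None = 0}
    = 4 ^ CARD('m) * fact (2 * CARD('m))"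
proof -
  let ?H = "half_powers (2 * CARD('m))"
  let ?V = "{v :: 'm + 'm \<Rightarrow> real. bij_betw (\<lambda>i. \<bar>v i\<bar>) UNIV ?H}"
  have iff: "w \<in> weights \<longleftrightarrow> (\<lambda>i. w (Some i)) \<in> ?V" if "w None = 0"
    for w :: "('m + 'm) option \<Rightarrow> real"
  proof -
    have "bij_betw (Some :: 'm + 'm \<Rightarrow> _) UNIV (range Some)"
      by (simp add: inj_on_imp_bij_betw)
    from bij_betw_comp_iff[OF this, of "\<lambda>i. \<bar>w i\<bar>" ?H]
    have "(\<lambda>i. w (Some i)) \<in> ?V \<longleftrightarrow> bij_betw (\<lambda>i. \<bar>w i\<bar>) (range Some) ?H"
      by (simp add: comp_def)
    also have "\<dots> \<longleftrightarrow> bij_betw (\<lambda>i. \<bar>w i\<bar>) (range Some \<union> {None}) (?H \<union> {\<bar>w None\<bar>})"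
      by (rule notIn_Un_bij_betw3) (auto simp: that half_powers_facts)
    also have "\<dots> \<longleftrightarrow> w \<in> weights"
      by (simp add: weights_def that UNIV_option_conv)
    finally show ?thesis ..
  qed
  have "bij_betw (case_option 0) ?V {w. w \<in> weights \<and> w None = 0}"
    by (rule bij_betw_byWitness[where f' = "\<lambda>w i. w (Some i)"])
      (auto simp: iff fun_eq_iff split: option.split)
  then have "card {w :: ('m + 'm) option \<Rightarrow> real. w \<in> weights \<and> w None = 0} = card ?V"
    by (rule bij_betw_same_card[symmetric])
  also have "card ?V = fact CARD('m + 'm) * 2 ^ card (?H - {0})"
    by (rule card_abs_bij_UNIV) (use half_powers_facts in auto)
  also have "CARD('m + 'm) = 2 * CARD('m)"
    by simp
  also have "(2 :: nat) ^ card (?H - {0}) = 4 ^ CARD('m)"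
    by (simp add: half_powers_facts power_mult)
  finally show ?thesis
    by (simp only: mult.commute)
qed

theorem corollary11:
  shows "card {f :: 4 ^ 'm \<Rightarrow> nat. compact_magic_hypercube f}
           = 4 ^ CARD('m) * fact (2 * CARD('m) + 1) \<and>
         card {f :: 4 ^ 'm \<Rightarrow> nat. most_perfect_magic_hypercube f}
           = 4 ^ CARD('m) * fact (2 * CARD('m))"
proof
  show "card {f :: 4 ^ 'm \<Rightarrow> nat. compact_magic_hypercube f} = 4 ^ CARD('m) * fact (2 * CARD('m) + 1)"
    unfolding compact_magic_hypercubes card_image[OF inj_on_labeling] by (rule card_weights)
  have "inj_on labeling {w :: ('m + 'm) option \<Rightarrow> real. w \<in> weights \<and> w None = 0}"
    using inj_on_labeling by (rule inj_on_subset) auto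
  then show "card {f :: 4 ^ 'm \<Rightarrow> nat. most_perfect_magic_hypercube f}
      = 4 ^ CARD('m) * fact (2 * CARD('m))"
    unfolding most_perfect_magic_hypercubes by (simp only: card_image card_weights_vanishing)
qed

end
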